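(* For every integer $q \geq 3$, the competition number of the Hamming graph $H(3,q)$ is $k(H(3,q)) = 6$.
   Context: For a positive integer $q$, let $[q]=\{1,2,\ldots,q\}$, and let $[q]^n$ be the set of $n$-tuples over $[q]$. For positive integers $n,q$, the Hamming graph $H(n,q)$ has vertex set $[q]^n$, and two vertices $x=(x_1,\ldots,x_n)$, $y=(y_1,\ldots,y_n)$ are adjacent if and only if $|\{i\in[n] \mid x_i\neq y_i\}|=1$. All graphs and digraphs are finite. The competition graph $C(D)$ of a digraph $D$ is the simple undirected graph with the same vertex set as $D$ in which two distinct vertices $u$ and $v$ are adjacent if and only if there is a vertex $x$ of $D$ such that both $(u,x)$ and $(v,x)$ are arcs of $D$. The competition number $k(G)$ of a graph $G$ is the smallest integer $k\geq 0$ such that $G$ together with $k$ additional isolated vertices is the competition graph of an acyclic digraph (a digraph with no directed cycles). *)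

theory Defs
  imports "Graph_Theory.Graph_Theory"
begin

text \<open>
  As in the Graph_Theory library, a simple undirected graph is a finite loop-free digraph with a
  symmetric arc relation (locale \<^locale>\<open>pair_graph\<close>), where \<^term>\<open>(u, v)\<close> being an arc means that
  \<^term>\<open>u\<close> and \<^term>\<open>v\<close> are adjacent. A finite digraph, possibly with loops, is a
  \<^locale>\<open>pair_fin_digraph\<close>.
\<close>

text \<open>
  A tuple $(x_1, \ldots, x_n)$ is the list of length \<open>n\<close> whose entry at position \<open>i\<close> (counting
  from 0) is $x_{i+1}$.
\<close>

definition hamming_graph :: "nat \<Rightarrow> nat \<Rightarrow> nat list pair_pre_digraph" where
  "hamming_graph n q =
    (let V = {x. length x = n \<and> set x \<subseteq> {1..q}} in
      \<lparr> pverts = V,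
        parcs = {(x, y). x \<in> V \<and> y \<in> V \<and> card {i. i < n \<and> x ! i \<noteq> y ! i} = 1} \<rparr>)"

definition competition_graph :: "'a pair_pre_digraph \<Rightarrow> 'a pair_pre_digraph" where
  "competition_graph D =
    \<lparr> pverts = pverts D,
      parcs = {(u, v). u \<in> pverts D \<and> v \<in> pverts D \<and> u \<noteq> v \<and>
                 (\<exists>x \<in> pverts D. (u, x) \<in> parcs D \<and> (v, x) \<in> parcs D)} \<rparr>"

text \<open>The library's \<^const>\<open>pre_digraph.cycle\<close> counts a loop as a cycle of length 1.\<close>

definition acyclic_digraph :: "'a pair_pre_digraph \<Rightarrow> bool" where
  "acyclic_digraph D \<longleftrightarrow> pair_fin_digraph D \<and> (\<nexists>p. pre_digraph.cycle (with_proj D) p)"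

text \<open>The sum type keeps the \<open>k\<close> new isolated vertices apart from the old ones.\<close>

definition add_isolated :: "'a pair_pre_digraph \<Rightarrow> nat \<Rightarrow> ('a + nat) pair_pre_digraph" where
  "add_isolated G k =
    \<lparr> pverts = Inl ` pverts G \<union> Inr ` {..<k}, parcs = map_prod Inl Inl ` parcs G \<rparr>"

definition competition_number :: "'a pair_pre_digraph \<Rightarrow> nat" where
  "competition_number G =
    (LEAST k. \<exists>D. acyclic_digraph D \<and> competition_graph D = add_isolated G k)"

lemma pair_graph_hamming_graph: "pair_graph (hamming_graph n q)"
proof -
  let ?H = "hamming_graph n q"
  have "finite {x. set x \<subseteq> {1..q} \<and> length x = n}"
    by (rule finite_lists_length_eq) simp
  then have fin: "finite (pverts ?H)"
    by (simp add: hamming_graph_def Let_def conj_commute)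
  have sub: "parcs ?H \<subseteq> pverts ?H \<times> pverts ?H"
    by (auto simp: hamming_graph_def Let_def)
  then have fin': "finite (parcs ?H)"
    using fin by (meson finite_SigmaI finite_subset)
  have "{i. i < n \<and> y ! i \<noteq> x ! i} = {i. i < n \<and> x ! i \<noteq> y ! i}" for x y :: "nat list"
    by auto
  then have flip: "card {i. i < n \<and> y ! i \<noteq> x ! i} = 1"
    if "card {i. i < n \<and> x ! i \<noteq> y ! i} = 1" for x y :: "nat list"
    using that by (rule ssubst)
  have "sym (parcs ?H)"
  proof (rule symI)
    fix x y
    assume "(x, y) \<in> parcs ?H"
    with flip show "(y, x) \<in> parcs ?H"
      unfolding hamming_graph_def Let_def pair_pre_digraph.simps mem_Collect_eq prod.case by blast
  qed
  then have "symmetric ?H"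
    by (simp add: symmetric_def)
  have loopfree: "fst e \<noteq> snd e" if "e \<in> parcs ?H" for e
    using that by (cases e) (auto simp: hamming_graph_def Let_def)
  show ?thesis
  proof
    show "fst e \<in> pverts ?H" "snd e \<in> pverts ?H" if "e \<in> parcs ?H" for e
      using that sub by auto
  qed (use fin fin' loopfree \<open>symmetric ?H\<close> in simp_all)
qed

lemma pair_graph_competition_graph:
  assumes "pair_fin_digraph D"
  shows "pair_graph (competition_graph D)"
proof -
  interpret pair_fin_digraph D by fact
  let ?C = "competition_graph D"
  have "parcs ?C \<subseteq> pverts D \<times> pverts D"
    by (auto simp: competition_graph_def)
  then have fin: "finite (parcs ?C)"
    using pair_finite_verts by (meson finite_SigmaI finite_subset)
  show ?thesis
    by unfold_locales
      (use fin pair_finite_verts in \<open>auto simp: competition_graph_def symmetric_def sym_def\<close>)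
qed

end

theory Submission
  imports Defs
begin

text \<open>
  Every clique of $H(3,q)$ with at least two vertices lies in a unique line, so in a digraph with
  the right competition graph distinct lines through a set of points need distinct common prey.
  Lower bound: choose five points closed under passing to a prey that is a point. Their prey are
  the \<open>k\<close> new vertices and at most four of the five points, while any five points meet at
  least ten lines; hence $10 \le k + 4$.
  Upper bound: it is enough to order the points so that for every \<open>m\<close> the first \<open>m\<close> points meet
  at most $m + 5$ lines, since then the lines can be given distinct prey greedily, each preceding
  all points of its line. Such an order starts with the cube $\{1,2\}^3$, continues with the points
  having two coordinates in $\{1,2\}$, and then those with one; from there on each new point
  lies on at least two lines already met.
\<close>

section \<open>Lines of a Hamming graph, adjacency and cliques\<close>

text \<open>
  Coordinates of points are positive, so 0 can mark the free coordinate of a line.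
\<close>

definition lines :: "nat list \<Rightarrow> nat list set" where
  "lines x = (\<lambda>i. x[i := 0]) ` {..<length x}"

abbreviation lines_of :: "nat list set \<Rightarrow> nat list set" where
  "lines_of S \<equiv> \<Union> (lines ` S)"

abbreviation points :: "nat \<Rightarrow> nat \<Rightarrow> nat list set" where
  "points n q \<equiv> {x. length x = n \<and> set x \<subseteq> {1..q}}"

lemma finite_lines [simp]: "finite (lines x)"
  by (simp add: lines_def)

lemma card_lines_le: "card (lines x) \<le> length x"
  unfolding lines_def by (metis card_image_le card_lessThan finite_lessThan)

lemma lines_triple [simp]: "lines [a, b, c] = {[0, b, c], [a, 0, c], [a, b, 0]}"
  by (auto simp: lines_def lessThan_Suc)

lemma finite_points: "finite (points n q)"
  using finite_lists_length_eq[of "{1..q}" n] by (simp add: conj_commute)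

lemma points_nth_pos: "x \<in> points n q \<Longrightarrow> i < n \<Longrightarrow> 0 < x ! i"
  by (force simp: subset_iff dest: nth_mem)

lemma line_index_unique:
  assumes "x \<in> points n q" "y \<in> points n q" "i < n" "j < n" "x[i := 0] = y[j := 0]"
  shows "i = j"
proof (rule ccontr)
  assume "i \<noteq> j"
  then have "x[i := 0] ! j = x ! j" by simp
  moreover have "x[i := 0] ! j = 0" using assms by simp
  ultimately show False using points_nth_pos[OF assms(1,4)] by simp
qed

lemma list_update_eq_iff_nth:
  assumes "length x = length y" "i < length x"
  shows "x[i := a] = y[i := a] \<longleftrightarrow> (\<forall>j < length x. j \<noteq> i \<longrightarrow> x ! j = y ! j)"
  using assms by (auto simp: list_eq_iff_nth_eq nth_list_update)

text \<open>Points differing only at \<open>i\<close> become equal once entry \<open>i\<close> is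
  overwritten by 0, and positive coordinates exclude coincidences between lines of different
  directions. Later arguments use adjacency only in this form.\<close>

lemma hamming_adjacent_iff:
  "(x, y) \<in> parcs (hamming_graph n q) \<longleftrightarrow>
     x \<in> points n q \<and> y \<in> points n q \<and> x \<noteq> y \<and> lines x \<inter> lines y \<noteq> {}"
proof (cases "x \<in> points n q \<and> y \<in> points n q")
  case True
  have "card {i. i < n \<and> x ! i \<noteq> y ! i} = 1 \<longleftrightarrow>
    (\<exists>i<n. x ! i \<noteq> y ! i \<and> (\<forall>j<n. j \<noteq> i \<longrightarrow> x ! j = y ! j))"
    by (auto simp: card_1_singleton_iff set_eq_iff)
  also have "\<dots> \<longleftrightarrow> (\<exists>i<n. x \<noteq> y \<and> x[i := 0] = y[i := 0])"
  proof -
    have len: "length x = n" "length y = n"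
      using True by auto
    have "x ! i \<noteq> y ! i \<longleftrightarrow> x \<noteq> y" if "\<forall>j<n. j \<noteq> i \<longrightarrow> x ! j = y ! j" for i
      using that len by (metis nth_equalityI)
    then have "(\<exists>i<n. x ! i \<noteq> y ! i \<and> (\<forall>j<n. j \<noteq> i \<longrightarrow> x ! j = y ! j)) \<longleftrightarrow>
        (\<exists>i<n. x \<noteq> y \<and> (\<forall>j<n. j \<noteq> i \<longrightarrow> x ! j = y ! j))"
      by blast
    then show ?thesis
      using len by (simp add: list_update_eq_iff_nth cong: conj_cong)
  qed
  also have "\<dots> \<longleftrightarrow> x \<noteq> y \<and> lines x \<inter> lines y \<noteq> {}"
  proof -
    have "\<And>i j. i < n \<Longrightarrow> j < n \<Longrightarrow> x[i := 0] = y[j := 0] \<Longrightarrow> i = j"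
      using True line_index_unique by blast
    then show ?thesis
      using True unfolding lines_def by (auto simp: disjoint_iff)
  qed
  finally show ?thesis
    using True by (simp add: hamming_graph_def Let_def)
qed (auto simp: hamming_graph_def Let_def)

text \<open>Points on a common line of direction \<open>i\<close> agree off \<open>i\<close>;
  sharing lines of two directions would make them agree everywhere.\<close>

lemma common_line_unique:
  assumes "x \<in> points n q" "y \<in> points n q" "x \<noteq> y"
    and "l \<in> lines x \<inter> lines y" "m \<in> lines x \<inter> lines y"
  shows "l = m"
proof -
  obtain i j where ij: "i < n" "j < n" "l = x[i := 0]" "m = x[j := 0]"
    using assms(1,4,5) by (auto simp: lines_def)
  then have "x[i := 0] = y[i := 0]" "x[j := 0] = y[j := 0]"
    using assms line_index_unique[OF assms(1,2)] by (auto simp: lines_def)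
  then have "i = j"
    using assms ij(1,2) by (auto simp: list_update_eq_iff_nth) (metis nth_equalityI)
  then show ?thesis using ij by simp
qed

text \<open>Let \<open>i\<close>, \<open>j\<close>, \<open>k\<close> be the directions of the lines
  joining \<open>x\<close> to \<open>y\<close>, \<open>x\<close> to \<open>z\<close> and
  \<open>y\<close> to \<open>z\<close>. If \<open>i\<close> and \<open>j\<close> differ, then
  \<open>x\<close> agrees with \<open>z\<close> but not with \<open>y\<close> at \<open>i\<close>,
  so \<open>k = i\<close>; then all three agree at \<open>j\<close>, which forces
  \<open>x = z\<close>.\<close>

lemma clique_on_line:
  assumes "x \<in> points n q" "y \<in> points n q" "z \<in> points n q" "x \<noteq> y"
    and l: "l \<in> lines x" "l \<in> lines y"
    and xz: "x = z \<or> lines x \<inter> lines z \<noteq> {}" and yz: "y = z \<or> lines y \<inter> lines z \<noteq> {}"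
  shows "l \<in> lines z"
proof (cases "x = z \<or> y = z")
  case False
  have same: "\<exists>i<n. m = u[i := 0] \<and> u[i := 0] = v[i := 0]"
    if "u \<in> points n q" "v \<in> points n q" "m \<in> lines u" "m \<in> lines v" for u v m
    using that line_index_unique[OF that(1,2)] by (auto simp: lines_def)
  obtain i where i: "i < n" "l = x[i := 0]" "x[i := 0] = y[i := 0]"
    using same assms(1,2) l by blast
  obtain j where j: "j < n" "x[j := 0] = z[j := 0]"
    using same[OF assms(1,3)] False xz by blast
  obtain k where k: "k < n" "y[k := 0] = z[k := 0]"
    using same[OF assms(2,3)] False yz by blast
  have len: "length x = n" "length y = n" "length z = n"
    using assms(1-3) by auto
  have xy: "x ! h = y ! h" if "h < n" "h \<noteq> i" for h
    using i that len list_update_eq_iff_nth by metis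
  have xz: "x ! h = z ! h" if "h < n" "h \<noteq> j" for h
    using j that len list_update_eq_iff_nth by metis
  have yz: "y ! h = z ! h" if "h < n" "h \<noteq> k" for h
    using k that len list_update_eq_iff_nth by metis
  have "i = j"
  proof (rule ccontr)
    assume "i \<noteq> j"
    moreover have "x ! i \<noteq> y ! i"
      using xy len \<open>x \<noteq> y\<close> by (metis nth_equalityI)
    ultimately have "k = i"
      using xz yz i(1) by metis
    then have "x ! j = z ! j"
      using xy yz j(1) \<open>i \<noteq> j\<close> by metis
    then have "x = z"
      using xz len by (metis nth_equalityI)
    then show False using False by simp
  qed
  then show ?thesis
    using i j len by (force simp: lines_def)
qed (use l in auto)

section \<open>Counting the lines met by five points\<close>

text \<open>Here \<open>a\<close> and \<open>b\<close> stand for the numbers of lines that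
  \<open>s\<close> points of a plane meet in its two directions. From 4ab \<le> (a + b)^2 it follows
  that a + b is at least 2, 3, 4, 4, 5 for s = 1, ..., 5; the conclusions are consequences that can
  be summed over slices.\<close>

lemma planar_bounds:
  fixes a b s :: nat
  assumes "s \<le> a * b" "0 < s" "s \<le> 5"
  shows "s \<le> a + b" "s \<le> 3 \<Longrightarrow> s + 1 \<le> a + b" "s \<le> 3 \<Longrightarrow> 4 * s \<le> 3 * (a + b)"
    "s \<le> 2 \<Longrightarrow> 3 * s \<le> 2 * (a + b)" "s \<le> 1 \<Longrightarrow> 2 * s \<le> a + b"
proof -
  have "4 * (a * b) \<le> (a + b)\<^sup>2"
    using sum_squares_ge_zero[of "int a - int b" 0]
    by (simp flip: of_nat_le_iff[where 'a = int] add: power2_eq_square algebra_simps)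
  then have f: "4 * s \<le> (a + b) * (a + b)"
    using assms(1) by (simp add: power2_eq_square)
  have *: "t < a + b" if "t * t < 4 * s" for t
    using f that by (metis le_less_trans less_le_trans linorder_not_less mult_le_mono not_less)
  have "s = 1 \<or> s = 2 \<or> s = 3 \<or> s = 4 \<or> s = 5" using assms by linarith
  then show "s \<le> a + b" "s \<le> 3 \<Longrightarrow> s + 1 \<le> a + b" "s \<le> 3 \<Longrightarrow> 4 * s \<le> 3 * (a + b)"
    "s \<le> 2 \<Longrightarrow> 3 * s \<le> 2 * (a + b)" "s \<le> 1 \<Longrightarrow> 2 * s \<le> a + b"
    using *[of 1] *[of 2] *[of 3] *[of 4] by auto
qed

text \<open>
  The slices of the five points by the last coordinate contribute separately to the lines in the
  other two directions, where \<open>planar_bounds\<close> applies; the lines in the last direction are at least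
  as many as the points in any slice.
\<close>

lemma five_points_meet_ten_lines:
  assumes S: "S \<subseteq> points 3 q" "card S = 5"
  shows "10 \<le> card (lines_of S)"
proof -
  define A where "A i T = (\<lambda>x. x[i := 0]) ` T" for i and T :: "nat list set"
  define slice where "slice z = {x \<in> S. x ! 2 = z}" for z
  define Z where "Z = (\<lambda>x. x ! 2) ` S"
  define s where "s z = card (slice z)" for z
  define f where "f z = card (A 0 (slice z)) + card (A 1 (slice z))" for z
  define M where "M = card (A 2 S)"
  have fin: "finite S" using S(2) card.infinite by fastforce
  have len: "length x = 3" if "x \<in> S" for x using S(1) that by auto
  have fin': "finite (slice z)" "finite Z" for z
    using fin by (auto simp: slice_def Z_def)
  have finA: "finite (A i T)" if "finite T" for i T using that by (simp add: A_def)
  have L: "lines_of S = A 0 S \<union> A 1 S \<union> A 2 S"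
    using len by (fastforce simp: lines_def A_def numeral_3_eq_3 numeral_2_eq_2 lessThan_Suc)
  have dis: "A i S \<inter> A j S = {}" if "i < 3" "j < 3" "i \<noteq> j" for i j
    using line_index_unique[of _ 3 q _ i j] S(1) that by (fastforce simp: A_def)
  have "card (A 0 S \<union> A 1 S) = card (A 0 S) + card (A 1 S)"
    using finA[OF fin] dis[of 0 1] by (simp add: card_Un_disjoint)
  moreover have "card (A 0 S \<union> A 1 S \<union> A 2 S) = card (A 0 S \<union> A 1 S) + card (A 2 S)"
    using finA[OF fin] dis[of 0 2] dis[of 1 2] by (intro card_Un_disjoint) auto
  ultimately have cardL: "card (lines_of S) = card (A 0 S) + card (A 1 S) + M"
    using L by (simp add: M_def)
  have S_un: "S = \<Union> (slice ` Z)"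
    by (auto simp: slice_def Z_def)
  have "card S = sum s Z"
    unfolding s_def by (subst S_un, rule card_UN_disjoint) (use fin' in \<open>auto simp: slice_def\<close>)
  then have sum_s: "sum s Z = 5" using S(2) by simp
  have A_sum: "card (A i S) = (\<Sum>z\<in>Z. card (A i (slice z)))" if "i < 2" for i
  proof -
    have "A i S = (\<Union>z\<in>Z. A i (slice z))"
      unfolding A_def by (subst S_un) blast
    moreover have "A i (slice z) \<inter> A i (slice z') = {}" if "z \<noteq> z'" for z z'
    proof -
      have "x[i := 0] \<noteq> y[i := 0]" if "x \<in> slice z" "y \<in> slice z'" for x y
      proof
        assume "x[i := 0] = y[i := 0]"
        then have "x[i := 0] ! 2 = y[i := 0] ! 2" by simp
        then show False using \<open>i < 2\<close> \<open>z \<noteq> z'\<close> that by (simp add: slice_def)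
      qed
      then show ?thesis by (auto simp: A_def)
    qed
    ultimately show ?thesis
      using fin' finA by (simp add: card_UN_disjoint)
  qed
  have sum_f: "card (lines_of S) = sum f Z + M"
    using cardL A_sum[of 0] A_sum[of 1] by (simp add: f_def sum.distrib)
  \<comment> \<open>Points of one slice share the last coordinate, so their lines in the last
    direction are distinct.\<close>
  have s_le_M: "s z \<le> M" for z
  proof -
    have "inj_on (\<lambda>x. x[2 := 0]) (slice z)"
    proof (rule inj_onI)
      fix x y :: "nat list" assume xy: "x \<in> slice z" "y \<in> slice z" "x[2 := 0] = y[2 := 0]"
      then have "x[2 := z] = y[2 := z]" by (metis list_update_overwrite)
      moreover have "x[2 := z] = x" "y[2 := z] = y"
        using xy(1,2) list_update_id[of x 2] list_update_id[of y 2] by (auto simp: slice_def)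
      ultimately show "x = y" by simp
    qed
    then have "s z = card (A 2 (slice z))" by (simp add: A_def s_def card_image)
    also have "\<dots> \<le> M"
      unfolding M_def using finA[OF fin] by (intro card_mono) (auto simp: A_def slice_def)
    finally show ?thesis .
  qed
  \<comment> \<open>The lines of a point in directions 0 and 1 together determine all its
    coordinates.\<close>
  have s_le: "s z \<le> card (A 0 (slice z)) * card (A 1 (slice z))" for z
  proof -
    have "inj_on (\<lambda>x. (x[0 := 0], x[1 := 0])) (slice z)"
    proof (rule inj_onI)
      fix x y :: "nat list"
      assume "x \<in> slice z" "y \<in> slice z" "(x[0 := 0], x[1 := 0]) = (y[0 := 0], y[1 := 0])"
      then have xy: "length x = 3" "length y = 3" "x[0 := 0] = y[0 := 0]" "x[1 := 0] = y[1 := 0]"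
        using len by (auto simp: slice_def)
      show "x = y"
      proof (rule nth_equalityI)
        fix i assume "i < length x"
        then show "x ! i = y ! i"
          using xy by (cases "i = 0") (auto simp: list_update_eq_iff_nth)
      qed (use xy in simp)
    qed
    then have "s z \<le> card (A 0 (slice z) \<times> A 1 (slice z))"
      unfolding s_def by (rule card_inj_on_le) (use fin' finA in \<open>auto simp: A_def\<close>)
    then show ?thesis by (simp add: card_cartesian_product)
  qed
  have s_pos: "0 < s z" if "z \<in> Z" for z
    using that fin' by (auto simp: s_def Z_def slice_def card_gt_0_iff)
  have s5: "s z \<le> 5" if "z \<in> Z" for z
    using member_le_sum[OF that, of s] fin' sum_s by simp
  note pb = planar_bounds[OF s_le s_pos s5, folded f_def]
  \<comment> \<open>The bounds 5, 6, 7, 8, 10 on \<open>sum f Z\<close> match \<open>M\<close> being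
    arbitrary or at most 4, 3, 2, 1, so that \<open>sum f Z + M\<close> is at least 10 in every
    case.\<close>
  have "5 \<le> sum f Z"
    using sum_mono[of Z s f] pb(1) sum_s by simp
  moreover have "6 \<le> sum f Z" if M4: "M \<le> 4"
  proof -
    \<comment> \<open>Otherwise every slice has exactly 4 points, but 4 does not divide 5. A slice
      with at most 3 points makes the comparison of \<open>s\<close> with \<open>f\<close>
      strict.\<close>
    have "\<exists>z\<in>Z. s z \<le> 3"
    proof (rule ccontr)
      assume "\<not> ?thesis"
      then have "s z = 4" if "z \<in> Z" for z
        using that M4 s_le_M[of z] by force
      then have "sum s Z = card Z * 4" by simp
      then show False using sum_s by presburger
    qed
    then have "sum s Z < sum f Z"
      using pb(1,2) fin' by (intro sum_strict_mono_ex1) (auto simp: Suc_le_eq)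
    then show ?thesis using sum_s by simp
  qed
  moreover have "7 \<le> sum f Z" if "M \<le> 3"
  proof -
    have "4 * sum s Z \<le> 3 * sum f Z"
      unfolding sum_distrib_left using pb(3) s_le_M that order_trans by (intro sum_mono) blast
    then show ?thesis using sum_s by simp
  qed
  moreover have "8 \<le> sum f Z" if "M \<le> 2"
  proof -
    have "3 * sum s Z \<le> 2 * sum f Z"
      unfolding sum_distrib_left using pb(4) s_le_M that order_trans by (intro sum_mono) blast
    then show ?thesis using sum_s by simp
  qed
  moreover have "10 \<le> sum f Z" if "M \<le> 1"
  proof -
    have "2 * sum s Z \<le> sum f Z"
      unfolding sum_distrib_left using pb(5) s_le_M that order_trans by (intro sum_mono) blast
    then show ?thesis using sum_s by simp
  qed
  ultimately show ?thesis
    unfolding sum_f by linarith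
qed

section \<open>Acyclic digraphs and the lower bound\<close>

text \<open>Since a closed walk yields a cycle, cycles can be traded for the transitive closure of
  \<open>parcs D\<close>, where well-foundedness applies.\<close>

lemma acyclic_digraph_iff:
  "acyclic_digraph D \<longleftrightarrow> pair_fin_digraph D \<and> acyclic (parcs D)"
proof (cases "pair_fin_digraph D")
  case True
  then interpret pair_fin_digraph D .
  have "(\<exists>p. cycle p) \<longleftrightarrow> (\<exists>p. closed_w p)"
    using closed_w_imp_cycle cycle_altdef by blast
  also have "\<dots> \<longleftrightarrow> (\<exists>u p. awalk u p u \<and> p \<noteq> [])"
    by (auto simp: closed_w_def)
  also have "\<dots> \<longleftrightarrow> \<not> acyclic (parcs D)"
    using reachable1_awalk by (auto simp: acyclic_def)
  finally show ?thesis
    using True by (auto simp: acyclic_digraph_def)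
qed (simp add: acyclic_digraph_def)

lemma finite_acyclic_has_sink:
  assumes "finite r" "acyclic r" "A \<noteq> {}"
  shows "\<exists>x\<in>A. \<forall>y\<in>A. (x, y) \<notin> r"
proof -
  have "wf (r\<inverse>)"
    using assms(1,2) by (simp add: finite_acyclic_wf_converse)
  then show ?thesis
    using assms(3) by (force simp: wf_eq_minimal)
qed

text \<open>Grow \<open>S\<close> one vertex at a time by a sink of \<open>r\<close> within
  \<open>V - S\<close>: all its successors in \<open>V\<close> are already in
  \<open>S\<close>.\<close>

lemma ex_closed_subset_of_card:
  assumes "finite r" "acyclic r" "finite V" "m \<le> card V"
  shows "\<exists>S\<subseteq>V. card S = m \<and> (\<forall>x\<in>S. \<forall>y\<in>V. (x, y) \<in> r \<longrightarrow> y \<in> S)"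
  using assms(4)
proof (induction m)
  case 0
  show ?case by (intro exI[of _ "{}"]) simp
next
  case (Suc m)
  then obtain S where S: "S \<subseteq> V" "card S = m" "\<forall>x\<in>S. \<forall>y\<in>V. (x, y) \<in> r \<longrightarrow> y \<in> S"
    by auto
  then have "V - S \<noteq> {}"
    using Suc.prems by auto
  then obtain p where p: "p \<in> V - S" "\<forall>y\<in>V - S. (p, y) \<notin> r"
    using finite_acyclic_has_sink[OF assms(1,2), of "V - S"] by auto
  have "finite S"
    using S(1) assms(3) finite_subset by blast
  then have "card (insert p S) = Suc m"
    using S(2) p(1) by simp
  moreover have "\<forall>x\<in>insert p S. \<forall>y\<in>V. (x, y) \<in> r \<longrightarrow> y \<in> insert p S"
    using S(3) p(2) by blast
  ultimately show ?case
    using S(1) p(1) by blast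
qed

lemma competition_hamming_lower_bound:
  fixes D :: "(nat list + nat) pair_pre_digraph"
  assumes q: "3 \<le> q" and D: "acyclic_digraph D"
    and comp: "competition_graph D = add_isolated (hamming_graph 3 q) k"
  shows "6 \<le> k"
proof -
  let ?V = "points 3 q"
  have D': "pair_fin_digraph D" "acyclic (parcs D)"
    using D by (auto simp: acyclic_digraph_iff)
  interpret pair_fin_digraph D by fact
  have vD: "pverts D = Inl ` ?V \<union> Inr ` {..<k}"
    using comp by (simp add: competition_graph_def add_isolated_def hamming_graph_def Let_def)
  have adj: "(\<exists>z. (Inl x, z) \<in> parcs D \<and> (Inl y, z) \<in> parcs D) \<longleftrightarrow> lines x \<inter> lines y \<noteq> {}"
    if "x \<in> ?V" "y \<in> ?V" "x \<noteq> y" for x y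
  proof -
    have "(Inl x, Inl y) \<in> parcs (competition_graph D) \<longleftrightarrow> (x, y) \<in> parcs (hamming_graph 3 q)"
      by (auto simp: comp add_isolated_def)
    then show ?thesis
      using that arc_snd_in_verts
      by (fastforce simp: hamming_adjacent_iff competition_graph_def vD)
  qed
  \<comment> \<open>These are the arcs between points. Finiteness and acyclicity pass from
    \<open>parcs D\<close> to \<open>r\<close>, so a closed set can be chosen among the points
    alone.\<close>
  define r where "r = {(x, y). (Inl x, Inl y) \<in> parcs D}"
  have "map_prod Inl Inl ` r \<subseteq> parcs D"
    by (auto simp: r_def)
  then have "finite r"
    using pair_finite_arcs by (metis finite_subset finite_imageD inj_on_subset prod.inj_map inj_Inl subset_UNIV)
  have "(Inl x, Inl y) \<in> (parcs D)\<^sup>+" if "(x, y) \<in> r\<^sup>+" for x y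
    using that by induction (auto simp: r_def intro: trancl_into_trancl)
  then have "acyclic r"
    using D'(2) by (auto simp: acyclic_def)
  \<comment> \<open>A 3 by 3 grid of points shows that there are at least five.\<close>
  define h where "h = (\<lambda>(a, b). [a, b, 1::nat])"
  have "card ({1..3::nat} \<times> {1..3::nat}) \<le> card ?V"
    by (rule card_inj_on_le[of h, OF _ _ finite_points]) (use q in \<open>auto simp: h_def inj_on_def\<close>)
  then have "5 \<le> card ?V" by simp
  then obtain S where S: "S \<subseteq> ?V" "card S = 5" "\<And>x y. x \<in> S \<Longrightarrow> y \<in> ?V \<Longrightarrow> (x, y) \<in> r \<Longrightarrow> y \<in> S"
    using ex_closed_subset_of_card[OF \<open>finite r\<close> \<open>acyclic r\<close> finite_points] by meson
  have "finite S" "S \<noteq> {}"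
    using S(2) card.infinite by fastforce+
  \<comment> \<open>A sink of the converse relation within \<open>S\<close> is a point
    \<open>t\<close> that is prey of no point of \<open>S\<close>. This leaves four possible prey in
    \<open>S\<close> instead of five.\<close>
  have "finite (r\<inverse>)" "acyclic (r\<inverse>)"
    using \<open>finite r\<close> \<open>acyclic r\<close> by auto
  then obtain t where t: "t \<in> S" "\<forall>x\<in>S. (x, t) \<notin> r"
    using finite_acyclic_has_sink[of "r\<inverse>" S] \<open>S \<noteq> {}\<close> by auto
  define prey where "prey = Inl ` (S - {t}) \<union> Inr ` {..<k}"
  have prey: "z \<in> prey" if "x \<in> S" "(Inl x, z) \<in> parcs D" for x z
  proof -
    have "z \<in> pverts D" using arc_snd_in_verts[OF that(2)] by simp
    then show ?thesis
      using that S(3) t(2) by (auto simp: vD prey_def r_def)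
  qed
  \<comment> \<open>The predator \<open>x\<close> lies in \<open>S\<close>, which puts
    \<open>z\<close> into \<open>prey\<close>; \<open>y\<close> may be any other point of the line,
    as the line may meet \<open>S\<close> only once.\<close>
  define covers where "covers z l \<longleftrightarrow> (\<exists>x y. x \<in> S \<and> y \<in> ?V \<and> x \<noteq> y \<and> l \<in> lines x \<inter> lines y \<and>
      (Inl x, z) \<in> parcs D \<and> (Inl y, z) \<in> parcs D)" for z l
  have "\<exists>z. covers z l" if "l \<in> lines_of S" for l
  proof -
    obtain x where x: "x \<in> S" "l \<in> lines x" using \<open>l \<in> lines_of S\<close> by auto
    then have xV: "x \<in> ?V" using S(1) by auto
    then obtain i where i: "i < 3" "l = x[i := 0]"
      using x(2) by (auto simp: lines_def)
    define y where "y = x[i := (if x ! i = 1 then 2 else 1)]"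
    have "y ! i \<noteq> x ! i" using xV i(1) by (simp add: y_def)
    then have "x \<noteq> y" by auto
    moreover have "y \<in> ?V"
      using xV q set_update_subset_insert[of x i] by (fastforce simp: y_def)
    moreover have "l \<in> lines x \<inter> lines y"
      using x(2) xV i by (auto simp: lines_def y_def intro!: image_eqI[where x = i])
    ultimately show ?thesis
      unfolding covers_def using adj[OF xV, of y] x(1) by blast
  qed
  then obtain g where g: "\<And>l. l \<in> lines_of S \<Longrightarrow> covers (g l) l"
    by metis
  \<comment> \<open>The predators of \<open>g l\<close> among the points form a clique containing
    two points of \<open>l\<close>, so all of them lie on \<open>l\<close>. If \<open>g m\<close> is
    the same vertex, two points of \<open>m\<close> are among them and share both \<open>l\<close>
    and \<open>m\<close>.\<close>
  have "inj_on g (lines_of S)"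
  proof (rule inj_onI)
    fix l m assume lm: "l \<in> lines_of S" "m \<in> lines_of S" "g l = g m"
    obtain x y where xy: "x \<in> ?V" "y \<in> ?V" "x \<noteq> y" "l \<in> lines x" "l \<in> lines y"
        "(Inl x, g l) \<in> parcs D" "(Inl y, g l) \<in> parcs D"
      using g[OF lm(1)] S(1) unfolding covers_def by blast
    obtain u v where uv: "u \<in> ?V" "v \<in> ?V" "u \<noteq> v" "m \<in> lines u" "m \<in> lines v"
        "(Inl u, g l) \<in> parcs D" "(Inl v, g l) \<in> parcs D"
      using g[OF lm(2)] S(1) unfolding covers_def lm(3)[symmetric] by blast
    have "l \<in> lines w" if "w \<in> ?V" "(Inl w, g l) \<in> parcs D" for w
      using clique_on_line[OF xy(1,2) that(1) xy(3-5)] adj[OF xy(1) that(1)] adj[OF xy(2) that(1)]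
        xy(6,7) that(2) by blast
    then show "l = m"
      using common_line_unique[OF uv(1-3), of l m] uv by simp
  qed
  moreover have "g ` lines_of S \<subseteq> prey"
  proof (rule image_subsetI)
    fix l assume "l \<in> lines_of S"
    from g[OF this] show "g l \<in> prey"
      unfolding covers_def using prey by blast
  qed
  moreover have "finite prey"
    using \<open>finite S\<close> by (simp add: prey_def)
  ultimately have "card (lines_of S) \<le> card prey"
    using card_inj_on_le by blast
  also have "\<dots> = 4 + k"
    unfolding prey_def using \<open>finite S\<close> t(1) S(2)
    by (subst card_Un_disjoint) (auto simp: card_image)
  finally show ?thesis
    using five_points_meet_ten_lines[OF S(1,2)] by linarith
qed

section \<open>From an ordering of the points to an acyclic digraph\<close>

text \<open>
  The last premise of \<open>insert\<close> is Hall's condition: the lines met after adding \<open>p\<close> must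
  find distinct prey among the earlier points and the \<open>k\<close> isolated vertices.
\<close>

inductive orderable :: "nat \<Rightarrow> nat list set \<Rightarrow> bool" for k where
  empty: "orderable k {}"
| insert: "orderable k S \<Longrightarrow> p \<notin> S \<Longrightarrow> card (lines_of (insert p S)) \<le> card S + k \<Longrightarrow>
    orderable k (insert p S)"

lemma orderable_finite: "orderable k S \<Longrightarrow> finite S"
  by (induction rule: orderable.induct) auto

lemma orderable_imp_assignment:
  assumes "orderable k S"
  shows "\<exists>\<phi> r. inj_on \<phi> (lines_of S) \<and> \<phi> ` lines_of S \<subseteq> Inl ` S \<union> Inr ` {..<k} \<and>
    (\<forall>x\<in>S. \<forall>l\<in>lines x. r (\<phi> l) < (r (Inl x) :: nat))"
  using assms
proof induction
  case empty
  show ?case by simp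
next
  case (insert S p)
  then obtain \<phi> r where \<phi>: "inj_on \<phi> (lines_of S)" "\<phi> ` lines_of S \<subseteq> Inl ` S \<union> Inr ` {..<k}"
    and r: "\<forall>x\<in>S. \<forall>l\<in>lines x. r (\<phi> l) < (r (Inl x) :: nat)"
    by blast
  define A where "A = Inl ` S \<union> Inr ` {..<k}"
  define N where "N = lines p - lines_of S"
  have "finite S" using insert.hyps orderable_finite by blast
  then have fin: "finite A" "finite (lines_of S)" "finite N"
    by (auto simp: A_def N_def)
  have "card A = card S + k"
    unfolding A_def using \<open>finite S\<close> by (subst card_Un_disjoint) (auto simp: card_image)
  moreover have "card (lines_of (insert p S)) = card (lines_of S) + card N"
    using fin by (subst card_Un_disjoint[symmetric]) (auto simp: N_def intro!: arg_cong[of _ _ card])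
  moreover have "card (A - \<phi> ` lines_of S) = card A - card (lines_of S)"
    using \<phi> fin by (simp add: A_def card_Diff_subset card_image)
  ultimately have "card N \<le> card (A - \<phi> ` lines_of S)"
    using insert.hyps by linarith
  then obtain \<psi> where \<psi>: "\<psi> ` N \<subseteq> A - \<phi> ` lines_of S" "inj_on \<psi> N"
    using card_le_inj[OF fin(3), of "A - \<phi> ` lines_of S"] fin(1) by blast
  define \<phi>' where "\<phi>' l = (if l \<in> lines_of S then \<phi> l else \<psi> l)" for l
  define r' where "r' = r(Inl p := Suc (Max (r ` A)))"
  have L: "lines_of (insert p S) = lines_of S \<union> N"
    by (auto simp: N_def)
  have inj: "inj_on \<phi>' (lines_of (insert p S))"
    unfolding L
  proof (rule inj_on_Un[THEN iffD2], intro conjI)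
    show "inj_on \<phi>' (lines_of S)"
      using \<phi>(1) by (simp add: \<phi>'_def inj_on_def)
    show "inj_on \<phi>' N"
      using \<psi>(2) by (auto simp: \<phi>'_def inj_on_def N_def)
    show "\<phi>' ` (lines_of S - N) \<inter> \<phi>' ` (N - lines_of S) = {}"
      using \<psi>(1) by (auto simp: \<phi>'_def N_def)
  qed
  have sub: "\<phi>' l \<in> A" if "l \<in> lines_of (insert p S)" for l
    using that \<phi>(2) \<psi>(1) unfolding L \<phi>'_def A_def[symmetric] by auto
  have pA: "Inl p \<notin> A"
    using insert.hyps by (auto simp: A_def)
  have r_A: "r' z = r z" "r z < r' (Inl p)" if "z \<in> A" for z
    using that pA fin(1) by (auto simp: r'_def le_imp_less_Suc)
  have "r' (\<phi>' l) < r' (Inl x)" if "x \<in> insert p S" "l \<in> lines x" for x l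
  proof (cases "x = p")
    case True
    have "\<phi>' l \<in> A" using sub that by blast
    then show ?thesis using r_A True by simp
  next
    case False
    then have x: "x \<in> S" "l \<in> lines_of S" using that by auto
    then have "\<phi>' l = \<phi> l" "\<phi> l \<in> A" "Inl x \<in> A"
      using \<phi>(2) by (auto simp: \<phi>'_def A_def)
    then show ?thesis
      using r x(1) that(2) r_A(1) by simp
  qed
  moreover have "\<phi>' ` lines_of (insert p S) \<subseteq> Inl ` insert p S \<union> Inr ` {..<k}"
    using sub by (auto simp: A_def)
  ultimately show ?case
    using inj by blast
qed

text \<open>Let each point prey on the \<open>\<phi>\<close>-images of its lines. By injectivity a
  common prey means a common line, and arcs lower the rank \<open>r\<close>, so no cycle arises. The
  \<open>Inr\<close> vertices have no outgoing arcs and thus stay isolated.\<close>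

lemma competition_hamming_upper_bound:
  assumes "orderable k (points n q)"
  shows "\<exists>D. acyclic_digraph D \<and> competition_graph D = add_isolated (hamming_graph n q) k"
proof -
  let ?V = "points n q"
  obtain \<phi> r where "inj_on \<phi> (lines_of ?V) \<and> \<phi> ` lines_of ?V \<subseteq> Inl ` ?V \<union> Inr ` {..<k} \<and>
      (\<forall>x\<in>?V. \<forall>l\<in>lines x. r (\<phi> l) < (r (Inl x) :: nat))"
    using orderable_imp_assignment[OF assms] by (elim exE)
  then have inj: "inj_on \<phi> (lines_of ?V)"
    and sub: "\<phi> ` lines_of ?V \<subseteq> Inl ` ?V \<union> Inr ` {..<k}"
    and r: "\<And>x l. x \<in> ?V \<Longrightarrow> l \<in> lines x \<Longrightarrow> r (\<phi> l) < r (Inl x)"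
    by auto
  define D where "D = \<lparr>pverts = Inl ` ?V \<union> Inr ` {..<k},
    parcs = (\<lambda>(x, l). (Inl x, \<phi> l)) ` (SIGMA x:?V. lines x)\<rparr>"
  have arc: "(u, z) \<in> parcs D \<longleftrightarrow> (\<exists>x\<in>?V. \<exists>l\<in>lines x. u = Inl x \<and> z = \<phi> l)" for u z
    by (auto simp: D_def image_iff)
  have in_D: "\<phi> l \<in> pverts D" if "x \<in> ?V" "l \<in> lines x" for x l
  proof -
    have "\<phi> l \<in> \<phi> ` lines_of ?V" using that by blast
    then show ?thesis using sub unfolding D_def by auto
  qed
  have "pair_fin_digraph D"
  proof
    show "finite (pverts D)" "finite (parcs D)"
      using finite_points by (auto simp: D_def)
  next
    fix e assume "e \<in> parcs D"
    then obtain x l where "x \<in> ?V" "l \<in> lines x" "e = (Inl x, \<phi> l)"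
      by (cases e) (auto simp: arc)
    then show "fst e \<in> pverts D" "snd e \<in> pverts D"
      using in_D by (auto simp: D_def)
  qed
  moreover have "acyclic (parcs D)"
  proof -
    have arc_less: "r v < r u" if "(u, v) \<in> parcs D" for u v
      using that r unfolding arc by blast
    have "r v < r u" if "(u, v) \<in> (parcs D)\<^sup>+" for u v
      using that by induction (use arc_less less_trans in metis)+
    then show ?thesis by (auto simp: acyclic_def)
  qed
  ultimately have "acyclic_digraph D"
    by (simp add: acyclic_digraph_iff)
  have common: "(\<exists>z\<in>pverts D. (u, z) \<in> parcs D \<and> (v, z) \<in> parcs D) \<longleftrightarrow>
      (\<exists>x\<in>?V. \<exists>y\<in>?V. u = Inl x \<and> v = Inl y \<and> lines x \<inter> lines y \<noteq> {})" for u v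
  proof
    assume "\<exists>z\<in>pverts D. (u, z) \<in> parcs D \<and> (v, z) \<in> parcs D"
    then obtain z where "(u, z) \<in> parcs D" "(v, z) \<in> parcs D"
      by blast
    then obtain x l y m where xy: "x \<in> ?V" "y \<in> ?V" "u = Inl x" "v = Inl y"
        and lm: "l \<in> lines x" "m \<in> lines y" "\<phi> l = \<phi> m"
      unfolding arc by (elim bexE conjE) simp
    have "l = m"
      by (rule inj_onD[OF inj lm(3)]) (use xy lm in blast)+
    then show "\<exists>x\<in>?V. \<exists>y\<in>?V. u = Inl x \<and> v = Inl y \<and> lines x \<inter> lines y \<noteq> {}"
      using xy lm by blast
  next
    assume "\<exists>x\<in>?V. \<exists>y\<in>?V. u = Inl x \<and> v = Inl y \<and> lines x \<inter> lines y \<noteq> {}"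
    then obtain x y l where xy: "x \<in> ?V" "y \<in> ?V" "u = Inl x" "v = Inl y"
        and l: "l \<in> lines x" "l \<in> lines y"
      by blast
    moreover have "\<phi> l \<in> pverts D"
      using in_D xy(1) l(1) .
    ultimately show "\<exists>z\<in>pverts D. (u, z) \<in> parcs D \<and> (v, z) \<in> parcs D"
      unfolding arc by blast
  qed
  have "(u, v) \<in> parcs (competition_graph D) \<longleftrightarrow>
      (u, v) \<in> parcs (add_isolated (hamming_graph n q) k)" for u v
  proof -
    have "(u, v) \<in> parcs (competition_graph D) \<longleftrightarrow> u \<noteq> v \<and>
        (\<exists>x\<in>?V. \<exists>y\<in>?V. u = Inl x \<and> v = Inl y \<and> lines x \<inter> lines y \<noteq> {})"
      unfolding competition_graph_def pair_pre_digraph.simps mem_Collect_eq prod.case common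
      by (auto simp: D_def)
    also have "\<dots> \<longleftrightarrow> (\<exists>x y. u = Inl x \<and> v = Inl y \<and> (x, y) \<in> parcs (hamming_graph n q))"
      unfolding hamming_adjacent_iff by blast
    also have "\<dots> \<longleftrightarrow> (u, v) \<in> parcs (add_isolated (hamming_graph n q) k)"
      by (auto simp: add_isolated_def)
    finally show ?thesis .
  qed
  then have "parcs (competition_graph D) = parcs (add_isolated (hamming_graph n q) k)"
    by auto
  moreover have "pverts (competition_graph D) = pverts (add_isolated (hamming_graph n q) k)"
    by (simp add: competition_graph_def add_isolated_def hamming_graph_def D_def Let_def)
  ultimately have "competition_graph D = add_isolated (hamming_graph n q) k"
    by (intro pair_pre_digraph.equality) simp_all
  then show ?thesis
    using \<open>acyclic_digraph D\<close> by blast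
qed

section \<open>Ordering the points of H(3,q)\<close>

text \<open>The number \<open>c\<close> bounds the excess of lines met over points. For
  \<open>k = 6\<close> the premise of \<open>orderable.insert\<close> says that the excess after the
  insertion is at most 5.\<close>

definition balanced :: "nat list set \<Rightarrow> nat \<Rightarrow> bool" where
  "balanced S c \<longleftrightarrow> orderable 6 S \<and> card (lines_of S) \<le> card S + c"

text \<open>At most \<open>3 - card L\<close> lines and exactly one point are added, so the excess
  changes by at most \<open>2 - card L\<close>.\<close>

lemma balanced_insert:
  assumes "balanced S c" "p \<notin> S" "length p = 3" "L \<subseteq> lines p" "L \<subseteq> lines_of S"
    and "c + 2 \<le> c' + card L" "c' \<le> 5"
  shows "balanced (insert p S) c'"
proof -
  have fin: "finite S"
    using assms(1) orderable_finite by (auto simp: balanced_def)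
  have "lines_of (insert p S) = lines_of S \<union> (lines p - L)"
    using assms(5) by auto
  then have "card (lines_of (insert p S)) \<le> card (lines_of S) + card (lines p - L)"
    using card_Un_le by metis
  also have "card (lines p - L) = card (lines p) - card L"
    using assms(4) by (meson card_Diff_subset finite_lines finite_subset)
  finally have "card (lines_of (insert p S)) \<le> card (lines_of S) + (3 - card L)"
    using card_lines_le[of p] assms(3) by linarith
  moreover have "card L \<le> 3"
    using card_mono[OF finite_lines assms(4)] card_lines_le[of p] assms(3) by linarith
  ultimately have "card (lines_of (insert p S)) \<le> card S + 1 + c'"
    using assms(1,6) unfolding balanced_def by linarith
  then show ?thesis
    using assms(1,2,7) fin by (auto simp: balanced_def intro: orderable.insert)
qed

text \<open>A new point on two lines already met adds at most one line, so the excess does not grow.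
  The old lines are met by \<open>S\<close> itself, so the points of \<open>T\<close> can come in
  any order.\<close>

lemma balanced_fill:
  assumes "balanced S c" "c \<le> 5" "finite T"
    and "\<And>p. p \<in> T \<Longrightarrow> length p = 3"
    and "\<And>p. p \<in> T \<Longrightarrow> \<exists>L. L \<subseteq> lines p \<and> L \<subseteq> lines_of S \<and> 2 \<le> card L"
  shows "balanced (S \<union> T) c"
  using assms(3-)
proof (induction T)
  case empty
  then show ?case using assms(1) by simp
next
  case (insert p T)
  show ?case
  proof (cases "p \<in> S \<union> T")
    case True
    then show ?thesis using insert by (simp add: insert_absorb)
  next
    case False
    obtain L where "L \<subseteq> lines p" "L \<subseteq> lines_of S" "2 \<le> card L"
      using insert.prems(2)[of p] by auto
    moreover have "balanced (S \<union> T) c" "length p = 3"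
      using insert by auto
    ultimately have "balanced (insert p (S \<union> T)) c"
      using False assms(2) by (intro balanced_insert[where L = L]) auto
    then show ?thesis by simp
  qed
qed

definition cube :: "nat list set" where
  "cube = {[1, 1, 1], [2, 1, 1], [1, 2, 1], [2, 2, 1], [1, 1, 2], [2, 1, 2], [1, 2, 2], [2, 2, 2]}"

text \<open>The excess runs through 2, 3, 4, 4, 5, 5, 5, 4, ending with the 12 edge lines against 8
  corners.\<close>

lemma balanced_cube: "balanced cube 4"
proof -
  have "balanced {} 0"
    by (simp add: balanced_def orderable.empty)
  then have "balanced {[1, 1, 1]} 2"
    by (rule balanced_insert[where L = "{}"]) auto
  then have "balanced {[2, 1, 1], [1, 1, 1]} 3"
    by (rule balanced_insert[where L = "{[0, 1, 1]}"]) auto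
  then have "balanced {[1, 2, 1], [2, 1, 1], [1, 1, 1]} 4"
    by (rule balanced_insert[where L = "{[1, 0, 1]}"]) auto
  then have "balanced {[2, 2, 1], [1, 2, 1], [2, 1, 1], [1, 1, 1]} 4"
    by (rule balanced_insert[where L = "{[0, 2, 1], [2, 0, 1]}"]) auto
  then have "balanced {[1, 1, 2], [2, 2, 1], [1, 2, 1], [2, 1, 1], [1, 1, 1]} 5"
    by (rule balanced_insert[where L = "{[1, 1, 0]}"]) auto
  then have "balanced {[2, 1, 2], [1, 1, 2], [2, 2, 1], [1, 2, 1], [2, 1, 1], [1, 1, 1]} 5"
    by (rule balanced_insert[where L = "{[0, 1, 2], [2, 1, 0]}"]) auto
  then have "balanced {[1, 2, 2], [2, 1, 2], [1, 1, 2], [2, 2, 1], [1, 2, 1], [2, 1, 1], [1, 1, 1]} 5"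
    by (rule balanced_insert[where L = "{[1, 0, 2], [1, 2, 0]}"]) auto
  then have "balanced (insert [2, 2, 2]
      {[1, 2, 2], [2, 1, 2], [1, 1, 2], [2, 2, 1], [1, 2, 1], [2, 1, 1], [1, 1, 1]}) 4"
    by (rule balanced_insert[where L = "{[0, 2, 2], [2, 0, 2], [2, 2, 0]}"]) auto
  then show ?thesis
    by (simp add: cube_def insert_commute)
qed

text \<open>
  The four points of an arm form a square parallel to a face of the cube and meet 1, 2, 2 and 3
  old lines when added one after the other, so they restore the excess of lines over points.
\<close>

definition arm :: "nat \<Rightarrow> nat \<Rightarrow> nat list set" where
  "arm i m = (\<lambda>c. c[i := m]) ` cube"

text \<open>Each \<open>b\<close> is a line through a corner that is already met, and the
  \<open>s\<close> lines are the sides, with \<open>p4\<close> opposite \<open>p1\<close>. The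
  bounds run 5, 5, 5, 4.\<close>

lemma balanced_square:
  assumes S: "balanced S 4" and new: "S \<inter> {p1, p2, p3, p4} = {}"
    and old: "{b1, b2, b3, b4} \<subseteq> lines_of S"
    and len: "length p1 = 3" "length p2 = 3" "length p3 = 3" "length p4 = 3"
    and base: "b1 \<in> lines p1" "b2 \<in> lines p2" "b3 \<in> lines p3" "b4 \<in> lines p4"
    and side: "s12 \<in> lines p1 \<inter> lines p2" "s13 \<in> lines p1 \<inter> lines p3"
      "s24 \<in> lines p2 \<inter> lines p4" "s34 \<in> lines p3 \<inter> lines p4"
    and dist: "s12 \<noteq> b2" "s13 \<noteq> b3" "distinct [s24, s34, b4]" "distinct [p1, p2, p3, p4]"
  shows "balanced (S \<union> {p1, p2, p3, p4}) 4"
proof -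
  have "balanced (insert p1 S) 5"
    by (rule balanced_insert[OF S, where L = "{b1}"]) (use assms in auto)
  then have "balanced (insert p2 (insert p1 S)) 5"
    by (rule balanced_insert[where L = "{s12, b2}"]) (use assms in auto)
  then have "balanced (insert p3 (insert p2 (insert p1 S))) 5"
    by (rule balanced_insert[where L = "{s13, b3}"]) (use assms in auto)
  then have "balanced (insert p4 (insert p3 (insert p2 (insert p1 S)))) 4"
    by (rule balanced_insert[where L = "{s24, s34, b4}"]) (use assms in auto)
  then show ?thesis
    by (simp add: insert_commute)
qed

text \<open>Changing coordinate \<open>i\<close> of a cube point keeps it on its line of direction
  \<open>i\<close>, so every corner of the arm lies on a line met by the cube. The three directions
  differ only in the explicit points and lines.\<close>

lemma balanced_arm:
  assumes "balanced S 4" "cube \<subseteq> S" "i < 3" "S \<inter> arm i m = {}"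
  shows "balanced (S \<union> arm i m) 4"
proof -
  have sub: "lines_of cube \<subseteq> lines_of S"
    using assms(2) by blast
  consider "i = 0" | "i = 1" | "i = 2" using assms(3) by linarith
  then show ?thesis
  proof cases
    case 1
    then have arm: "arm i m = {[m, 1, 1], [m, 2, 1], [m, 1, 2], [m, 2, 2]}"
      by (auto simp: arm_def cube_def)
    have old: "{[0, 1, 1], [0, 2, 1], [0, 1, 2], [0, 2, 2]} \<subseteq> lines_of S"
      by (rule order_trans[OF _ sub]) (simp add: cube_def)
    show ?thesis
      unfolding arm
      by (rule balanced_square[OF assms(1) assms(4)[unfolded arm] old,
            of "[m, 0, 1]" "[m, 1, 0]" "[m, 2, 0]" "[m, 0, 2]"]) simp_all
  next
    case 2
    then have arm: "arm i m = {[1, m, 1], [2, m, 1], [1, m, 2], [2, m, 2]}"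
      by (auto simp: arm_def cube_def)
    have old: "{[1, 0, 1], [2, 0, 1], [1, 0, 2], [2, 0, 2]} \<subseteq> lines_of S"
      by (rule order_trans[OF _ sub]) (simp add: cube_def)
    show ?thesis
      unfolding arm
      by (rule balanced_square[OF assms(1) assms(4)[unfolded arm] old,
            of "[0, m, 1]" "[1, m, 0]" "[2, m, 0]" "[0, m, 2]"]) simp_all
  next
    case 3
    then have arm: "arm i m = {[1, 1, m], [2, 1, m], [1, 2, m], [2, 2, m]}"
      by (auto simp: arm_def cube_def)
    have old: "{[1, 1, 0], [2, 1, 0], [1, 2, 0], [2, 2, 0]} \<subseteq> lines_of S"
      by (rule order_trans[OF _ sub]) (simp add: cube_def)
    show ?thesis
      unfolding arm
      by (rule balanced_square[OF assms(1) assms(4)[unfolded arm] old,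
            of "[0, 1, m]" "[1, 0, m]" "[2, 0, m]" "[0, 2, m]"]) simp_all
  qed
qed

text \<open>For \<open>q\<close> at least 2 these are the points with at least two coordinates in
  {1, 2}, split into arms so that whole squares can be added in turn.\<close>

definition armed_cube :: "nat \<Rightarrow> nat list set" where
  "armed_cube q = cube \<union> (\<Union>(i, m)\<in>{..<3} \<times> {3..q}. arm i m)"

text \<open>Arms with \<open>m\<close> at least 3 miss the cube and each other: the position and
  value of the only coordinate above 2 determine the arm. Hence they can be added in any
  order.\<close>

lemma balanced_armed_cube: "balanced (armed_cube q) 4"
proof -
  have "finite F \<Longrightarrow> F \<subseteq> {..<3} \<times> {3..q} \<Longrightarrow> balanced (cube \<union> (\<Union>(i, m)\<in>F. arm i m)) 4" for F
  proof (induction rule: finite_induct)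
    case empty
    then show ?case using balanced_cube by simp
  next
    case (insert e F)
    obtain i m where e: "e = (i, m)" by (cases e)
    have im: "i < 3" "3 \<le> m" using insert.prems e by auto
    have cube: "length c = 3 \<and> (\<forall>j<3. c ! j \<le> 2)" if "c \<in> cube" for c
      using that by (auto simp: cube_def nth_Cons')
    have "x \<notin> cube \<union> (\<Union>(i, m)\<in>F. arm i m)" if "x \<in> arm i m" for x
    proof
      obtain c where c: "c \<in> cube" "x = c[i := m]" using \<open>x \<in> arm i m\<close> by (auto simp: arm_def)
      then have xi: "x ! i = m" using cube im by simp
      assume "x \<in> cube \<union> (\<Union>(i, m)\<in>F. arm i m)"
      then consider "x \<in> cube" | j k where "(j, k) \<in> F" "x \<in> arm j k" by auto
      then show False
      proof cases
        case 1
        then show False using cube im xi by force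
      next
        case 2
        then obtain d where d: "d \<in> cube" "x = d[j := k]" by (auto simp: arm_def)
        have "j < 3" using 2 insert.prems by auto
        show False
        proof (cases "i = j")
          case True
          then have "k = m" using d xi cube im by auto
          then show False using True 2 insert.hyps e by simp
        next
          case False
          then have "d ! i = m" using d xi by simp
          then show False using cube[OF d(1)] im by force
        qed
      qed
    qed
    then have "balanced ((cube \<union> (\<Union>(i, m)\<in>F. arm i m)) \<union> arm i m) 4"
      using insert im by (intro balanced_arm) auto
    then show ?case
      by (simp add: e Un_ac)
  qed
  then show ?thesis
    by (simp add: armed_cube_def)
qed

lemma armed_cube_memI:
  assumes "x \<in> {1..q}" "a \<in> {1, 2}" "b \<in> {1, 2}"
  shows "[x, a, b] \<in> armed_cube q" "[a, x, b] \<in> armed_cube q" "[a, b, x] \<in> armed_cube q"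
proof -
  have arms: "[x, a, b] \<in> arm 0 x" "[a, x, b] \<in> arm 1 x" "[a, b, x] \<in> arm 2 x"
    using assms(2,3) by (auto simp: arm_def cube_def)
  consider "x \<in> {1, 2}" | "x \<in> {3..q}" using assms(1) by force
  then have "{[x, a, b], [a, x, b], [a, b, x]} \<subseteq> armed_cube q"
  proof cases
    case 1
    then have "{[x, a, b], [a, x, b], [a, b, x]} \<subseteq> cube"
      using assms(2,3) by (auto simp: cube_def)
    then show ?thesis
      by (auto simp: armed_cube_def)
  next
    case 2
    then have "arm i x \<subseteq> armed_cube q" if "i < 3" for i
      using that by (auto simp: armed_cube_def)
    from this[of 0] this[of 1] this[of 2] show ?thesis
      using arms by auto
  qed
  then show "[x, a, b] \<in> armed_cube q" "[a, x, b] \<in> armed_cube q" "[a, b, x] \<in> armed_cube q"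
    by auto
qed

lemma orderable_points:
  assumes "2 \<le> q"
  shows "orderable 6 (points 3 q)"
proof -
  \<comment> \<open>These are the points with at least one coordinate in {1, 2}; the overlap with
    the armed cube is harmless for \<open>balanced_fill\<close>.\<close>
  define P where "P = {[x, y, z] | x y z.
    {x, y, z} \<subseteq> {1..q} \<and> (x \<in> {1, 2} \<or> y \<in> {1, 2} \<or> z \<in> {1, 2})}"
  have P_sub: "P \<subseteq> points 3 q"
    by (auto simp: P_def)
  have "balanced (armed_cube q) 5"
    using balanced_armed_cube[of q] by (auto simp: balanced_def)
  then have "balanced (armed_cube q \<union> P) 5"
  proof (rule balanced_fill)
    fix p assume "p \<in> P"
    then obtain x y z where p: "p = [x, y, z]" "x \<in> {1..q}" "y \<in> {1..q}" "z \<in> {1..q}"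
      and "x \<in> {1, 2} \<or> y \<in> {1, 2} \<or> z \<in> {1, 2}"
      by (auto simp: P_def)
    \<comment> \<open>Keep the coordinate that lies in {1, 2} and set one of the other two to 1:
      this gives two points of the armed cube, on different lines through \<open>p\<close>.\<close>
    then consider "x \<in> {1, 2}" | "y \<in> {1, 2}" | "z \<in> {1, 2}" by blast
    then show "\<exists>L. L \<subseteq> lines p \<and> L \<subseteq> lines_of (armed_cube q) \<and> 2 \<le> card L"
    proof cases
      case 1
      then have "[x, 1, z] \<in> armed_cube q" "[x, y, 1] \<in> armed_cube q"
        using p armed_cube_memI(2,3) by simp_all
      then show ?thesis
        using p by (intro exI[of _ "{[x, 0, z], [x, y, 0]}"]) force
    next
      case 2
      then have "[1, y, z] \<in> armed_cube q" "[x, y, 1] \<in> armed_cube q"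
        using p armed_cube_memI(1,3) by simp_all
      then show ?thesis
        using p by (intro exI[of _ "{[0, y, z], [x, y, 0]}"]) force
    next
      case 3
      then have "[1, y, z] \<in> armed_cube q" "[x, 1, z] \<in> armed_cube q"
        using p armed_cube_memI(1,2) by simp_all
      then show ?thesis
        using p by (intro exI[of _ "{[0, y, z], [x, 0, z]}"]) force
    qed
  qed (use P_sub finite_subset[OF P_sub finite_points] in auto)
  then have "balanced (armed_cube q \<union> P \<union> points 3 q) 5"
  proof (rule balanced_fill)
    fix p assume "p \<in> points 3 q"
    then obtain x y z where p: "p = [x, y, z]" "x \<in> {1..q}" "y \<in> {1..q}" "z \<in> {1..q}"
      by (auto simp: numeral_3_eq_3 length_Suc_conv)
    \<comment> \<open>Setting a coordinate of any point to 1 moves it into \<open>P\<close> along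
      one of its lines, so that line is already met.\<close>
    then have "[1, y, z] \<in> P" "[x, 1, z] \<in> P"
      by (auto simp: P_def)
    then show "\<exists>L. L \<subseteq> lines p \<and> L \<subseteq> lines_of (armed_cube q \<union> P) \<and> 2 \<le> card L"
      using p by (intro exI[of _ "{[0, y, z], [x, 0, z]}"]) force
  qed (use finite_points in auto)
  moreover have "armed_cube q \<subseteq> points 3 q"
    using assms by (auto simp: armed_cube_def arm_def cube_def numeral_3_eq_3 less_Suc_eq)
  then have "armed_cube q \<union> P \<union> points 3 q = points 3 q"
    using P_sub by blast
  ultimately show ?thesis
    by (simp add: balanced_def)
qed

theorem theorem5:
  fixes q :: nat
  assumes "q \<ge> 3"
  shows "competition_number (hamming_graph 3 q) = 6"
  unfolding competition_number_def
proof (rule Least_equality)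
  show "\<exists>D. acyclic_digraph D \<and> competition_graph D = add_isolated (hamming_graph 3 q) 6"
    using orderable_points assms by (intro competition_hamming_upper_bound) simp
  show "6 \<le> k"
    if "\<exists>D. acyclic_digraph D \<and> competition_graph D = add_isolated (hamming_graph 3 q) k" for k
    using that competition_hamming_lower_bound[OF assms] by blast
qed

end
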